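(* Let $D$ be an integral domain that is a valuation factorization domain (VFD). Then $D$ is integrally closed (in its quotient field).
   Context: Let $D$ be an integral domain with quotient field $K$. An overring of $D$ is a subring of $K$ containing $D$. A nonzero nonunit $a\in D$ is a valuation element of $D$ if there is a valuation domain $V$ that is an overring of $D$ with $aV\cap D=aD$. $D$ is a VFD (valuation factorization domain) if every nonzero nonunit of $D$ is a finite product of valuation elements. *)

theory Defs
  imports "HOL-Computational_Algebra.Computational_Algebra"
begin

text \<open>
  The integral domain \<open>D\<close> is a type \<open>'a :: idom\<close>; its quotient field \<open>K\<close> is the library type
  \<open>'a fract\<close>, into which \<open>D\<close> embeds by \<^const>\<open>to_fract\<close>.  Subrings of \<open>K\<close> are sets, so the image
  of \<open>D\<close> in \<open>K\<close> is \<open>range to_fract\<close>.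
\<close>

definition is_subring :: "'k::field set \<Rightarrow> bool" where
  "is_subring S \<longleftrightarrow> 1 \<in> S \<and> (\<forall>x\<in>S. \<forall>y\<in>S. x - y \<in> S \<and> x * y \<in> S)"

definition overring :: "'a::idom fract set \<Rightarrow> bool" where
  "overring S \<longleftrightarrow> is_subring S \<and> range to_fract \<subseteq> S"

text \<open>
  A valuation domain contains \<open>x\<close> or \<open>1/x\<close> for every nonzero \<open>x\<close> of its quotient field.  Here the
  ambient field plays the role of that quotient field.  For overrings of \<open>D\<close> this is no
  restriction: a subring of \<open>K\<close> containing \<open>D\<close> has quotient field \<open>K\<close>.
\<close>

definition valuation_domain :: "'k::field set \<Rightarrow> bool" where
  "valuation_domain V \<longleftrightarrow> is_subring V \<and> (\<forall>x. x \<noteq> 0 \<longrightarrow> x \<in> V \<or> inverse x \<in> V)"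

text \<open>The condition \<open>aV \<inter> D = aD\<close> is read inside \<open>K\<close>.\<close>

definition valuation_element :: "'a::idom \<Rightarrow> bool" where
  "valuation_element a \<longleftrightarrow> a \<noteq> 0 \<and> \<not> a dvd 1 \<and>
     (\<exists>V. valuation_domain V \<and> overring V \<and>
        (\<lambda>v. to_fract a * v) ` V \<inter> range to_fract = range (\<lambda>d. to_fract (a * d)))"

text \<open>
  The multiset of factors may contain repetitions; it is automatically nonempty, since the empty
  product is a unit.
\<close>

definition VFD :: "'a::idom itself \<Rightarrow> bool" where
  "VFD _ \<longleftrightarrow> (\<forall>a::'a. a \<noteq> 0 \<longrightarrow> \<not> a dvd 1 \<longrightarrow>
     (\<exists>A. (\<forall>x\<in>#A. valuation_element x) \<and> a = prod_mset A))"

definition integral_over_domain :: "'a::idom fract \<Rightarrow> bool" where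
  "integral_over_domain x \<longleftrightarrow> (\<exists>p::'a poly. lead_coeff p = 1 \<and> poly (fract_poly p) x = 0)"

definition integrally_closed :: "'a::idom itself \<Rightarrow> bool" where
  "integrally_closed _ \<longleftrightarrow> (\<forall>x::'a fract. integral_over_domain x \<longrightarrow> x \<in> range to_fract)"

end

theory Submission
  imports Defs
begin

text \<open>
  A valuation ring \<open>V\<close> containing \<open>D\<close> contains every element of \<open>K\<close> that is integral over \<open>D\<close>
  (\<open>integral_mem_valuation_overring\<close>).  The condition \<open>aV \<inter> D = aD\<close> says that dividing by \<open>a\<close>
  leads out of \<open>D\<close> only if it leads out of \<open>V\<close>: if \<open>y \<in> V\<close> and \<open>ay \<in> D\<close>, then \<open>y \<in> D\<close>.

  Let \<open>x \<in> K\<close> be integral over \<open>D\<close>.  If its denominator is a unit, then \<open>x \<in> D\<close>; otherwise the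
  denominator is a product of valuation elements, so that
  \<open>a\<^sub>1 \<cdots> a\<^sub>n x \<in> D\<close>.  The element \<open>y = a\<^sub>2 \<cdots> a\<^sub>n x\<close> lies in the valuation overring that
  belongs to \<open>a\<^sub>1\<close>, because \<open>x\<close> does, and \<open>a\<^sub>1 y \<in> D\<close>; hence \<open>y \<in> D\<close>.  So the factors of the
  denominator can be cancelled one at a time, although each of them has its own valuation overring
  (\<open>cancel_valuation_elements\<close>).
\<close>

lemma is_subring_closed:
  assumes "is_subring S"
  shows is_subring_one: "1 \<in> S"
    and is_subring_zero: "0 \<in> S"
    and is_subring_mult: "\<And>x y. x \<in> S \<Longrightarrow> y \<in> S \<Longrightarrow> x * y \<in> S"
    and is_subring_uminus: "\<And>x. x \<in> S \<Longrightarrow> - x \<in> S"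
    and is_subring_add: "\<And>x y. x \<in> S \<Longrightarrow> y \<in> S \<Longrightarrow> x + y \<in> S"
proof -
  show one: "1 \<in> S" and mult: "\<And>x y. x \<in> S \<Longrightarrow> y \<in> S \<Longrightarrow> x * y \<in> S"
    using assms by (auto simp: is_subring_def)
  have diff: "x - y \<in> S" if "x \<in> S" "y \<in> S" for x y
    using assms that by (auto simp: is_subring_def)
  show zero: "0 \<in> S"
    using diff[OF one one] by simp
  show uminus: "- x \<in> S" if "x \<in> S" for x
    using diff[OF zero that] by simp
  show "x + y \<in> S" if "x \<in> S" "y \<in> S" for x y
    using diff[OF that(1) uminus[OF that(2)]] by simp
qed

lemma is_subring_power: "is_subring S \<Longrightarrow> x \<in> S \<Longrightarrow> x ^ n \<in> S"
  by (induction n) (auto intro: is_subring_one is_subring_mult)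

lemma is_subring_sum:
  "is_subring S \<Longrightarrow> (\<And>i. i \<in> I \<Longrightarrow> f i \<in> S) \<Longrightarrow> sum f I \<in> S"
  by (induction I rule: infinite_finite_induct) (auto intro: is_subring_zero is_subring_add)

text \<open>
  If \<open>x\<close> is not in \<open>V\<close>, then \<open>x\<inverse>\<close> is.  Dividing a monic equation
  \<open>x\<^sup>n + c\<^sub>n\<^sub>-\<^sub>1 x\<^sup>n\<^sup>-\<^sup>1 + \<cdots> + c\<^sub>0 = 0\<close> by \<open>x\<^sup>n\<^sup>-\<^sup>1\<close> writes \<open>x\<close> as a polynomial in \<open>x\<inverse>\<close> with
  coefficients in \<open>D\<close>, so that \<open>x\<close> is in \<open>V\<close> after all.
\<close>

lemma integral_mem_valuation_overring:
  fixes x :: "'a::idom fract"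
  assumes V: "valuation_domain V" "overring V" and x: "integral_over_domain x"
  shows "x \<in> V"
proof (rule ccontr)
  assume "x \<notin> V"
  have S: "is_subring V"
    using V by (simp add: valuation_domain_def)
  have "x \<noteq> 0"
    using is_subring_zero[OF S] \<open>x \<notin> V\<close> by auto
  define y where "y = inverse x"
  have "y \<in> V"
    using V(1) \<open>x \<noteq> 0\<close> \<open>x \<notin> V\<close> by (auto simp: valuation_domain_def y_def)
  obtain p :: "'a poly" where p: "lead_coeff p = 1" "poly (fract_poly p) x = 0"
    using x by (auto simp: integral_over_domain_def)
  have "degree p \<noteq> 0"
  proof
    assume "degree p = 0"
    then have "p = 1"
      using p(1) by (metis degree_0_id one_pCons of_nat_1 degree_eq_zeroE coeff_pCons_0 degree_pCons_0)
    with p(2) show False by simp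
  qed
  then obtain n where n: "degree p = Suc n"
    using not0_implies_Suc by blast
  have "(\<Sum>i\<le>Suc n. to_fract (coeff p i) * x ^ i) = 0"
    using p(2) n by (simp add: poly_altdef degree_map_poly coeff_map_poly)
  then have "(\<Sum>i\<le>n. to_fract (coeff p i) * x ^ i) + x * x ^ n = 0"
    using p(1) n by simp
  then have "((\<Sum>i\<le>n. to_fract (coeff p i) * x ^ i) + x * x ^ n) * y ^ n = 0"
    by simp
  moreover have "x ^ i * y ^ n = y ^ (n - i)" if "i \<le> n" for i
  proof -
    have "y ^ n = y ^ i * y ^ (n - i)"
      using that by (simp flip: power_add)
    then show ?thesis
      using \<open>x \<noteq> 0\<close> by (simp add: y_def field_simps)
  qed
  ultimately have "(\<Sum>i\<le>n. to_fract (coeff p i) * y ^ (n - i)) + x = 0"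
    by (simp add: distrib_right sum_distrib_right mult.assoc)
  then have "x = - (\<Sum>i\<le>n. to_fract (coeff p i) * y ^ (n - i))"
    by (simp add: eq_neg_iff_add_eq_0 add.commute)
  also have "\<dots> \<in> V"
    using V(2) \<open>y \<in> V\<close>
    by (intro is_subring_uminus[OF S] is_subring_sum[OF S] is_subring_mult[OF S]
        is_subring_power[OF S]) (auto simp: overring_def)
  finally show False
    using \<open>x \<notin> V\<close> by simp
qed

text \<open>
  Membership in all valuation overrings is what makes the induction over the factors work: the
  overring changes from factor to factor, and each of them contains, along with \<open>x\<close> and \<open>D\<close>, the
  product of \<open>x\<close> with the factors that remain.
\<close>

lemma cancel_valuation_elements:
  fixes x :: "'a::idom fract"
  assumes x: "\<And>V. valuation_domain V \<Longrightarrow> overring V \<Longrightarrow> x \<in> V"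
    and "\<forall>a\<in>#A. valuation_element a"
    and "to_fract (prod_mset A) * x \<in> range to_fract"
  shows "x \<in> range to_fract"
  using assms(2,3)
proof (induction A)
  case empty
  then show ?case by simp
next
  case (add a A)
  obtain V where V: "valuation_domain V" "overring V" and "a \<noteq> 0"
    and aV: "(\<lambda>v. to_fract a * v) ` V \<inter> range to_fract = range (\<lambda>d. to_fract (a * d))"
    using add.prems(1) by (auto simp: valuation_element_def)
  define y where "y = to_fract (prod_mset A) * x"
  have "y \<in> V"
    using V x[OF V] unfolding y_def
    by (intro is_subring_mult) (auto simp: overring_def)
  moreover have "to_fract a * y \<in> range to_fract"
    using add.prems(2) by (simp add: y_def mult.assoc)
  ultimately have "to_fract a * y \<in> range (\<lambda>d. to_fract (a * d))"
    using aV by blast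
  then have "y \<in> range to_fract"
    using \<open>a \<noteq> 0\<close> by auto
  then show ?case
    using add.IH add.prems(1) by (simp add: y_def)
qed

theorem corollary1p5:
  assumes "VFD TYPE('a::idom)"
  shows "integrally_closed TYPE('a)"
  unfolding integrally_closed_def
proof (intro allI impI)
  fix x :: "'a fract"
  assume "integral_over_domain x"
  then have x: "x \<in> V" if "valuation_domain V" "overring V" for V
    using that integral_mem_valuation_overring by blast
  obtain b a where "a \<noteq> 0" and "x = Fract b a"
    by (cases x)
  then have bx: "to_fract a * x = to_fract b"
    by (simp add: to_fract_def eq_fract)
  show "x \<in> range to_fract"
  proof (cases "a dvd 1")
    case True
    then obtain c where "1 = a * c" ..
    then have "to_fract c * to_fract a = 1"
      by (metis mult.commute to_fract_1 to_fract_mult)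
    then have "x = to_fract (c * b)"
      using bx by (metis mult.assoc mult_1 to_fract_mult)
    then show ?thesis by blast
  next
    case False
    then obtain A where "\<forall>x\<in>#A. valuation_element x" and "a = prod_mset A"
      using assms \<open>a \<noteq> 0\<close> by (auto simp: VFD_def)
    then show ?thesis
      using cancel_valuation_elements[of x A] x bx by auto
  qed
qed

end
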